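(* Let $X$ be a Banach space as described in the context, and assume that the finite limit $\mu=\lim_{n\to\infty}\|z^n\|^{1/n}$ exists. Let $f\in X$ and $\rho,\sigma\in(0,\infty)$. Then $f$ is (the restriction to $\mathbb{D}$ of) an entire function of finite order $\rho$ and normal type $\sigma$ if and only if $$\limsup_{n\to\infty}\frac{n}{e\rho}\left(\frac{E_n(f)}{\|z^n\|}\right)^{\rho/n}=\sigma .$$
   Context: $\mathbb{D}=\{z\in\mathbb{C}:|z|<1\}$. $X$ is a complex Banach space of functions analytic in $\mathbb{D}$ whose norm $\|\cdot\|$ satisfies: (i) $\|f(\cdot\, e^{it})\|=\|f(\cdot)\|$ for all $t\in\mathbb{R}$ and $f\in X$; (ii) $\|f\|<\infty$ for every entire function $f$; (iii) for all $f\in X$ and $g\in L[0,2\pi]$, $\big\|\frac{1}{2\pi}\int_0^{2\pi} f(ze^{it})g(t)\,dt\big\|\le \frac{1}{2\pi}\int_0^{2\pi}|g(t)|\,dt\cdot\|f\|$. For $n\ge 1$, $\mathcal{P}_n$ is the set of complex polynomials of degree at most $n-1$, $E_n(f)=\inf_{p\in\mathcal{P}_n}\|f-p\|$, and $\|z^n\|$ is the norm in $X$ of the monomial $z\mapsto z^n$. For an entire function $F$ with $M(r)=\max_{|z|=r}|F(z)|$, its order is $\rho=\limsup_{r\to\infty}\frac{\ln\ln M(r)}{\ln r}$ and, when $0<\rho<\infty$, its type is $\limsup_{r\to\infty}\frac{\ln M(r)}{r^\rho}$; normal type means the type lies in $(0,\infty)$. *)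

theory Defs
  imports "HOL-Analysis.Analysis" "HOL-Computational_Algebra.Polynomial"
begin

text \<open>Elements of X are functions analytic in the unit disc D; we represent them
canonically as functions complex => complex that vanish outside D.\<close>

definition restrD :: "(complex \<Rightarrow> complex) \<Rightarrow> (complex \<Rightarrow> complex)" where
  "restrD F = (\<lambda>z. if z \<in> ball 0 1 then F z else 0)"

definition banach_analytic_space ::
  "(complex \<Rightarrow> complex) set \<Rightarrow> ((complex \<Rightarrow> complex) \<Rightarrow> real) \<Rightarrow> bool" where
  "banach_analytic_space X N \<longleftrightarrow>
     \<comment> \<open>functions analytic in D (vanishing outside D)\<close>
     (\<forall>f\<in>X. f analytic_on ball 0 1 \<and> (\<forall>z. z \<notin> ball 0 1 \<longrightarrow> f z = 0)) \<and>
     \<comment> \<open>complex vector space\<close>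
     (\<lambda>z. 0) \<in> X \<and>
     (\<forall>f\<in>X. \<forall>g\<in>X. (\<lambda>z. f z + g z) \<in> X) \<and>
     (\<forall>c. \<forall>f\<in>X. (\<lambda>z. c * f z) \<in> X) \<and>
     \<comment> \<open>norm\<close>
     (\<forall>f\<in>X. N f \<ge> 0) \<and>
     (\<forall>f\<in>X. N f = 0 \<longleftrightarrow> f = (\<lambda>z. 0)) \<and>
     (\<forall>c. \<forall>f\<in>X. N (\<lambda>z. c * f z) = cmod c * N f) \<and>
     (\<forall>f\<in>X. \<forall>g\<in>X. N (\<lambda>z. f z + g z) \<le> N f + N g) \<and>
     \<comment> \<open>completeness\<close>
     (\<forall>s. (\<forall>n. s n \<in> X) \<and>
          (\<forall>e>0. \<exists>M. \<forall>m\<ge>M. \<forall>n\<ge>M. N (\<lambda>z. s m z - s n z) < e) \<longrightarrow>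
          (\<exists>f\<in>X. (\<lambda>n. N (\<lambda>z. s n z - f z)) \<longlonglongrightarrow> 0)) \<and>
     \<comment> \<open>(i) rotation invariance\<close>
     (\<forall>f\<in>X. \<forall>t::real. (\<lambda>z. f (z * cis t)) \<in> X \<and> N (\<lambda>z. f (z * cis t)) = N f) \<and>
     \<comment> \<open>(ii) every entire function belongs to X (finite norm)\<close>
     (\<forall>F. F holomorphic_on UNIV \<longrightarrow> restrD F \<in> X) \<and>
     \<comment> \<open>(iii) convolution inequality\<close>
     (\<forall>f\<in>X. \<forall>g :: real \<Rightarrow> complex. integrable (lebesgue_on {0..2*pi}) g \<longrightarrow>
        (let h = restrD (\<lambda>z. (1 / (2*pi)) *
                    (LINT t|lebesgue_on {0..2*pi}. f (z * cis t) * g t))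
         in h \<in> X \<and>
            N h \<le> (1 / (2*pi)) * (LINT t|lebesgue_on {0..2*pi}. cmod (g t)) * N f))"

definition best_approx :: "((complex \<Rightarrow> complex) \<Rightarrow> real) \<Rightarrow> nat \<Rightarrow> (complex \<Rightarrow> complex) \<Rightarrow> real" where
  "best_approx N n f = Inf {N (\<lambda>z. f z - restrD (poly p) z) | p :: complex poly. degree p \<le> n - 1}"

definition monomial_norm :: "((complex \<Rightarrow> complex) \<Rightarrow> real) \<Rightarrow> nat \<Rightarrow> real" where
  "monomial_norm N n = N (restrD (\<lambda>z. z ^ n))"

definition max_modulus :: "(complex \<Rightarrow> complex) \<Rightarrow> real \<Rightarrow> real" where
  "max_modulus F r = Sup ((\<lambda>z. cmod (F z)) ` sphere 0 r)"

definition entire_order :: "(complex \<Rightarrow> complex) \<Rightarrow> ereal" where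
  "entire_order F = Limsup at_top (\<lambda>r. ereal (ln (ln (max_modulus F r)) / ln r))"

definition entire_type :: "(complex \<Rightarrow> complex) \<Rightarrow> real \<Rightarrow> ereal" where
  "entire_type F \<rho> = Limsup at_top (\<lambda>r. ereal (ln (max_modulus F r) / r powr \<rho>))"

end

theory Submission
  imports Defs "HOL-Complex_Analysis.Cauchy_Integral_Formula" "HOL-Real_Asymp.Real_Asymp"
begin

text \<open>
  Write \<open>f = \<Sum> a\<^sub>k z\<^sup>k\<close> and \<open>m\<^sub>k = \<parallel>z\<^sup>k\<parallel>\<close>. Convolution with \<open>exp (- i n t)\<close> annihilates polynomials of
  degree less than \<open>n\<close> and gives \<open>\<bar>a\<^sub>n\<bar> m\<^sub>n \<le> E\<^sub>n f\<close>; completeness gives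
  \<open>E\<^sub>n f \<le> \<Sum>k\<ge>n. \<bar>a\<^sub>k\<bar> m\<^sub>k\<close>, and also \<open>\<mu> > 0\<close>. Hence, if \<open>\<bar>a\<^sub>n\<bar> \<le> (e \<rho> \<tau> / n) powr (n / \<rho>)\<close> for all large
  \<open>n\<close>, then the tail is dominated by a geometric series, and since \<open>m\<^sub>n\<close> equals \<open>\<mu>\<^sup>n\<close> up to a subexponential
  factor, \<open>E\<^sub>n f / m\<^sub>n\<close> obeys the same bound with any larger \<open>\<tau>\<close>. On the other hand this bound on
  \<open>a\<^sub>n\<close> corresponds, up to enlarging \<open>\<tau>\<close>, to \<open>M r \<le> exp (\<tau> r powr \<rho>)\<close> for all large \<open>r\<close>. So the
  type and the limsup have the same positive upper bounds. That the order is \<open>\<rho>\<close> follows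
  from the type being finite and positive.
\<close>

section \<open>Coefficients and growth of entire functions\<close>

lemma ln_le_iff_le_exp: "x > 0 \<Longrightarrow> ln x \<le> y \<longleftrightarrow> x \<le> exp y" for x y :: real
  by (metis exp_le_cancel_iff exp_ln)

text \<open>Density of the reals reduces a limit superior to eventual non-strict bounds by every
  larger real constant. Order, type and the approximation quantity are all handled in this
  form.\<close>

lemma Limsup_ereal_le_iff:
  fixes u :: "'a \<Rightarrow> real"
  shows "Limsup F (\<lambda>x. ereal (u x)) \<le> ereal \<tau> \<longleftrightarrow> (\<forall>\<tau>'>\<tau>. eventually (\<lambda>x. u x \<le> \<tau>') F)"
proof
  assume "Limsup F (\<lambda>x. ereal (u x)) \<le> ereal \<tau>"
  then have *: "\<forall>y>ereal \<tau>. eventually (\<lambda>x. ereal (u x) < y) F"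
    by (simp only: Limsup_le_iff)
  show "\<forall>\<tau>'>\<tau>. eventually (\<lambda>x. u x \<le> \<tau>') F"
  proof (intro allI impI)
    fix \<tau>' assume "\<tau>' > \<tau>"
    then have "eventually (\<lambda>x. ereal (u x) < ereal \<tau>') F"
      using *[rule_format, of "ereal \<tau>'"] by (simp only: less_ereal.simps)
    then show "eventually (\<lambda>x. u x \<le> \<tau>') F" by eventually_elim simp
  qed
next
  assume ev: "\<forall>\<tau>'>\<tau>. eventually (\<lambda>x. u x \<le> \<tau>') F"
  show "Limsup F (\<lambda>x. ereal (u x)) \<le> ereal \<tau>"
    unfolding Limsup_le_iff
  proof (intro allI impI)
    fix y assume "ereal \<tau> < y"
    then obtain t where t: "ereal \<tau> < ereal t" "ereal t < y"
      using ereal_dense2 by blast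
    with ev have "eventually (\<lambda>x. u x \<le> t) F" by simp
    then show "eventually (\<lambda>x. ereal (u x) < y) F"
      by eventually_elim (use t in \<open>meson ereal_less_eq(3) order_le_less_trans\<close>)
  qed
qed

text \<open>A positive value is pinned down by its positive real upper bounds, and the growth bounds
  below are compared for \<open>\<tau> > 0\<close> only.\<close>

lemma ereal_eq_if_le_iff:
  fixes L T :: ereal and \<sigma> :: real
  assumes "\<And>\<tau>::real. \<tau> > 0 \<Longrightarrow> L \<le> ereal \<tau> \<longleftrightarrow> T \<le> ereal \<tau>"
    and "\<sigma> > 0"
  shows "L = ereal \<sigma> \<longleftrightarrow> T = ereal \<sigma>"
proof -
  have "B = ereal \<sigma>" if A: "A = ereal \<sigma>" and iff: "\<And>\<tau>::real. \<tau> > 0 \<Longrightarrow> A \<le> ereal \<tau> \<longleftrightarrow> B \<le> ereal \<tau>"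
    for A B :: ereal
  proof (rule ccontr)
    assume "B \<noteq> ereal \<sigma>"
    \<comment> \<open>Taking \<open>\<tau> = \<sigma>\<close> leaves only
      \<open>B < \<sigma>\<close>; the maximum with \<open>0\<close> keeps the separating number
      \<open>t\<close> positive.\<close>
    with A iff[of \<sigma>] \<open>\<sigma> > 0\<close> have "max B 0 < ereal \<sigma>" by auto
    then obtain t where t: "max B 0 < ereal t" "ereal t < ereal \<sigma>" using ereal_dense2 by blast
    then have "A \<le> ereal t" using iff[of t] by (auto simp: zero_ereal_def)
    with A t show False by simp
  qed
  with assms(1) show ?thesis by blast
qed

section \<open>The extremal size of Taylor coefficients\<close>

text \<open>For positive parameters and \<open>n > 0\<close> this is the minimum over
  \<open>R > 0\<close> of \<open>exp (\<tau> * R powr \<rho>) / R ^ n\<close>, the best that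
  Cauchy's estimate can give. At \<open>n = 0\<close> the conventions for division and
  \<open>powr\<close> yield \<open>0\<close>, so only positive or large \<open>n\<close> are
  meaningful.\<close>

definition coef_bound :: "real \<Rightarrow> real \<Rightarrow> nat \<Rightarrow> real" where
  "coef_bound \<rho> \<tau> n = (exp 1 * \<rho> * \<tau> / real n) powr (real n / \<rho>)"

lemma coef_bound_eq_power:
  assumes "\<rho> > 0" "\<tau> > 0" "n > 0"
  shows "coef_bound \<rho> \<tau> n = ((exp 1 * \<rho> * \<tau> / real n) powr (1 / \<rho>)) ^ n"
  using assms by (simp add: coef_bound_def powr_realpow[symmetric] powr_powr)

text \<open>Raising to the power \<open>n / \<rho>\<close> is monotone on nonnegative numbers; this
  gives the terms of the limit superior in the theorem the same shape as bounds on Taylor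
  coefficients.\<close>

lemma scaled_root_le_iff:
  assumes "\<rho> > 0" "\<tau> > 0" "n > 0" "b \<ge> 0"
  shows "real n / (exp 1 * \<rho>) * b powr (\<rho> / real n) \<le> \<tau> \<longleftrightarrow> b \<le> coef_bound \<rho> \<tau> n"
proof -
  have b: "b = (b powr (\<rho> / real n)) powr (real n / \<rho>)"
    using assms by (simp add: powr_powr)
  have "real n / (exp 1 * \<rho>) * b powr (\<rho> / real n) \<le> \<tau>
      \<longleftrightarrow> b powr (\<rho> / real n) \<le> exp 1 * \<rho> * \<tau> / real n"
    using assms by (simp add: field_simps)
  also have "\<dots> \<longleftrightarrow> (b powr (\<rho> / real n)) powr (real n / \<rho>) \<le> coef_bound \<rho> \<tau> n"
    unfolding coef_bound_def using assms
    by (smt (verit) divide_pos_pos mult_pos_pos of_nat_0_less_iff powr_ge_zero powr_less_mono2 powr_mono2 exp_gt_zero)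
  finally show ?thesis using b by simp
qed

text \<open>Collected into one exponential, the product depends on \<open>R\<close> only through
  \<open>\<rho> * \<tau> * R powr \<rho> / n\<close>, so optimising the radius becomes a
  one-variable question.\<close>

lemma coef_bound_mult_power:
  assumes "\<rho> > 0" "\<tau> > 0" "n > 0" "R > 0"
  shows "coef_bound \<rho> \<tau> n * R ^ n
    = exp (real n / \<rho> * (1 + ln (\<rho> * \<tau> * R powr \<rho> / real n)))"
proof -
  define y where "y = \<rho> * \<tau> / real n"
  have y: "y > 0" using assms by (simp add: y_def)
  have "coef_bound \<rho> \<tau> n = (exp 1 * y) powr (real n / \<rho>)"
    by (simp add: coef_bound_def y_def mult.assoc)
  also have "\<dots> = exp (real n / \<rho> * (1 + ln y))"
    using y by (simp add: powr_def ln_mult)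
  finally have "coef_bound \<rho> \<tau> n * R ^ n = exp (real n / \<rho> * (1 + ln y)) * exp (real n * ln R)"
    using assms by (simp add: exp_of_nat_mult)
  also have "\<dots> = exp (real n / \<rho> * (1 + ln y) + real n * ln R)"
    by (simp add: exp_add)
  also have "real n / \<rho> * (1 + ln y) + real n * ln R = real n / \<rho> * (1 + (ln y + \<rho> * ln R))"
    using assms by (simp add: distrib_left)
  also have "ln y + \<rho> * ln R = ln (y * R powr \<rho>)"
    using y assms by (simp add: ln_mult)
  finally show ?thesis by (simp add: y_def)
qed

text \<open>With \<open>y = \<rho> \<tau> R powr \<rho> / n\<close> the claim reads \<open>(e y) powr (n / \<rho>) \<le> exp (n y / \<rho>)\<close>,
  i.e. \<open>1 + ln y \<le> y\<close>, with equality for \<open>y = 1\<close>.\<close>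

lemma coef_bound_mult_power_le:
  assumes "\<rho> > 0" "\<tau> > 0" "n > 0" "R > 0"
  shows "coef_bound \<rho> \<tau> n * R ^ n \<le> exp (\<tau> * R powr \<rho>)"
proof -
  define y where "y = \<rho> * \<tau> * R powr \<rho> / real n"
  have "y > 0" using assms by (simp add: y_def)
  then have "1 + ln y \<le> y" using ln_le_minus_one[of y] by simp
  then have "real n / \<rho> * (1 + ln y) \<le> real n / \<rho> * y"
    using assms by (intro mult_left_mono) auto
  also have "\<dots> = \<tau> * R powr \<rho>" using assms by (simp add: y_def)
  finally show ?thesis using assms by (simp add: coef_bound_mult_power y_def)
qed

text \<open>At this radius \<open>1 + ln y \<le> y\<close> is sharp; Cauchy's estimate on its circle
  thus gives exactly \<open>coef_bound\<close>.\<close>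

lemma coef_bound_eq_at_optimal_radius:
  assumes "\<rho> > 0" "\<tau> > 0" "n > 0"
  defines "R \<equiv> (real n / (\<rho> * \<tau>)) powr (1 / \<rho>)"
  shows "coef_bound \<rho> \<tau> n = exp (\<tau> * R powr \<rho>) / R ^ n"
proof -
  have R: "R powr \<rho> = real n / (\<rho> * \<tau>)" "R > 0"
    using assms by (simp_all add: R_def powr_powr)
  have "coef_bound \<rho> \<tau> n * R ^ n = exp (\<tau> * R powr \<rho>)"
    using assms R by (subst coef_bound_mult_power) auto
  then show ?thesis using R by (simp add: field_simps)
qed

text \<open>Enlarging \<open>\<tau>\<close> gains the factor
  \<open>(\<tau>' / \<tau>) powr (n / \<rho>)\<close>, which outruns any constant.\<close>

lemma coef_bound_eventually_mult_le:
  assumes "\<rho> > 0" "\<tau> > 0" "\<tau> < \<tau>'"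
  shows "eventually (\<lambda>n. C * coef_bound \<rho> \<tau> n \<le> coef_bound \<rho> \<tau>' n) sequentially"
proof -
  have "filterlim (\<lambda>n. (\<tau>' / \<tau>) powr (real n / \<rho>)) at_top sequentially"
  proof -
    have "filterlim (\<lambda>n. exp (ln (\<tau>' / \<tau>) * (real n / \<rho>))) at_top sequentially"
    proof -
      have "ln (\<tau>' / \<tau>) > 0" using assms by simp
      then show ?thesis using assms(1) by real_asymp
    qed
    then show ?thesis using assms by (simp add: powr_def mult.commute)
  qed
  then have "eventually (\<lambda>n. C \<le> (\<tau>' / \<tau>) powr (real n / \<rho>)) sequentially"
    by (simp add: filterlim_at_top)
  then show ?thesis
    using eventually_gt_at_top[of 0]
  proof eventually_elim
    case (elim n)
    have "coef_bound \<rho> \<tau>' n = (\<tau>' / \<tau>) powr (real n / \<rho>) * coef_bound \<rho> \<tau> n"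
      unfolding coef_bound_def using assms elim by (subst powr_mult[symmetric]) (auto simp: mult_ac)
    with elim show ?case
      by (simp add: coef_bound_def mult_right_mono)
  qed
qed

lemma coef_bound_root_tendsto_0:
  assumes "\<rho> > 0" "\<tau> > 0"
  shows "(\<lambda>n. (exp 1 * \<rho> * \<tau> / real n) powr (1 / \<rho>)) \<longlonglongrightarrow> 0"
proof -
  have "(\<lambda>n. exp 1 * \<rho> * \<tau> / real n) \<longlonglongrightarrow> 0" by real_asymp
  then show ?thesis
    using assms by (intro tendsto_zero_powrI[where b = "1 / \<rho>"]) auto
qed

text \<open>Root test: the \<open>n\<close>-th roots of \<open>coef_bound\<close> tend to
  \<open>0\<close>, which beats every fixed \<open>R\<close>.\<close>

lemma summable_if_coef_bound:
  fixes a :: "nat \<Rightarrow> complex"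
  assumes "\<rho> > 0" "\<tau> > 0"
    and "eventually (\<lambda>n. cmod (a n) \<le> coef_bound \<rho> \<tau> n) sequentially"
  shows "summable (\<lambda>n. cmod (a n) * R ^ n)"
proof (rule summable_comparison_test_ev)
  define c where "c n = (exp 1 * \<rho> * \<tau> / real n) powr (1 / \<rho>)" for n
  have "(\<lambda>n. c n * \<bar>R\<bar>) \<longlonglongrightarrow> 0"
    using tendsto_mult_right[OF coef_bound_root_tendsto_0[OF assms(1,2)], of "\<bar>R\<bar>"] by (simp add: c_def)
  then have "eventually (\<lambda>n. c n * \<bar>R\<bar> < 1 / 2) sequentially"
    by (rule order_tendstoD) simp
  then show "eventually (\<lambda>n. norm (cmod (a n) * R ^ n) \<le> (1 / 2) ^ n) sequentially"
    using assms(3) eventually_gt_at_top[of 0]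
  proof eventually_elim
    case (elim n)
    have "norm (cmod (a n) * R ^ n) \<le> c n ^ n * \<bar>R\<bar> ^ n"
      using elim assms by (simp add: abs_mult power_abs coef_bound_eq_power c_def mult_right_mono)
    also have "\<dots> = (c n * \<bar>R\<bar>) ^ n" by (simp add: power_mult_distrib)
    also have "\<dots> \<le> (1 / 2) ^ n" using elim by (intro power_mono) (auto simp: c_def)
    finally show ?case .
  qed
qed simp

section \<open>Entire functions and their maximum modulus\<close>

lemma sums_holomorphic_UNIV:
  assumes "\<And>z::complex. (\<lambda>n. a n * z ^ n) sums F z"
  shows "F holomorphic_on UNIV"
proof -
  have "F holomorphic_on ball 0 r" for r
    by (rule power_series_holomorphic[where a = a]) (use assms in simp)
  then have "F field_differentiable at z" for z
    by (rule holomorphic_on_imp_differentiable_at[of _ "ball 0 (cmod z + 1)"]) auto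
  then show ?thesis by (simp add: holomorphic_on_def field_differentiable_at_within)
qed

lemma bdd_above_cmod_sphere:
  assumes "F holomorphic_on UNIV"
  shows "bdd_above ((\<lambda>z. cmod (F z)) ` sphere 0 r)"
proof -
  have "continuous_on (sphere 0 r) F"
    using assms by (meson holomorphic_on_imp_continuous_on holomorphic_on_subset subset_UNIV)
  then have "compact ((\<lambda>z. cmod (F z)) ` sphere 0 r)"
    by (intro compact_continuous_image continuous_on_norm) auto
  then show ?thesis by (intro bounded_imp_bdd_above compact_imp_bounded)
qed

lemma norm_le_max_modulus:
  assumes "F holomorphic_on UNIV" "cmod z = r"
  shows "cmod (F z) \<le> max_modulus F r"
  unfolding max_modulus_def
  using assms bdd_above_cmod_sphere by (intro cSUP_upper) auto

lemma max_modulus_le: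
  assumes "r \<ge> 0" "\<And>z. cmod z = r \<Longrightarrow> cmod (F z) \<le> B"
  shows "max_modulus F r \<le> B"
  unfolding max_modulus_def
proof (rule cSUP_least)
  have "complex_of_real r \<in> sphere 0 r" using assms by simp
  then show "sphere (0::complex) r \<noteq> {}" by blast
qed (use assms in auto)

lemma max_modulus_nonneg:
  assumes "F holomorphic_on UNIV" "r \<ge> 0"
  shows "max_modulus F r \<ge> 0"
  using order_trans[OF norm_ge_zero norm_le_max_modulus[OF assms(1), of "complex_of_real r" r]] assms(2)
  by simp

lemma Cauchy_coefficient_estimate:
  assumes "F holomorphic_on UNIV" "r > 0"
  shows "cmod ((deriv ^^ n) F 0 / fact n) * r ^ n \<le> max_modulus F r"
proof -
  have "norm ((deriv ^^ n) F 0) \<le> fact n * max_modulus F r / r ^ n"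
  proof (rule Cauchy_inequality)
    show "F holomorphic_on ball 0 r" "continuous_on (cball 0 r) F"
      using assms holomorphic_on_subset holomorphic_on_imp_continuous_on by blast+
    show "cmod (F x) \<le> max_modulus F r" if "cmod (0 - x) = r" for x
      using norm_le_max_modulus[OF assms(1), of x r] that by simp
  qed (use assms in simp)
  then show ?thesis using assms by (simp add: norm_divide field_simps)
qed

section \<open>The type in terms of Taylor coefficients\<close>

lemma entire_type_le_iff:
  assumes "F holomorphic_on UNIV" "\<tau> > 0"
  shows "entire_type F \<rho> \<le> ereal \<tau>
    \<longleftrightarrow> (\<forall>\<tau>'>\<tau>. eventually (\<lambda>r. max_modulus F r \<le> exp (\<tau>' * r powr \<rho>)) at_top)"
proof -
  have "eventually (\<lambda>r. ln (max_modulus F r) / r powr \<rho> \<le> \<tau>') at_top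
      \<longleftrightarrow> eventually (\<lambda>r. max_modulus F r \<le> exp (\<tau>' * r powr \<rho>)) at_top" if "\<tau>' > \<tau>" for \<tau>'
  proof (rule eventually_cong[OF eventually_gt_at_top[of 0]])
    fix r :: real assume "r > 0"
    then have M: "max_modulus F r \<ge> 0" using max_modulus_nonneg assms by simp
    have "ln (max_modulus F r) / r powr \<rho> \<le> \<tau>' \<longleftrightarrow> ln (max_modulus F r) \<le> \<tau>' * r powr \<rho>"
      using \<open>r > 0\<close> by (simp add: field_simps)
    also have "\<dots> \<longleftrightarrow> max_modulus F r \<le> exp (\<tau>' * r powr \<rho>)"
    \<comment> \<open>Since \<open>ln 0 = 0\<close>, both sides hold for vanishing maximum modulus,
      the left one because \<open>\<tau>' > 0\<close>.\<close>
    proof (cases "max_modulus F r = 0")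
      case False
      with M have "max_modulus F r > 0" by simp
      then show ?thesis using exp_le_cancel_iff[of "ln (max_modulus F r)" "\<tau>' * r powr \<rho>"] by simp
    qed (use that assms in auto)
    finally show "ln (max_modulus F r) / r powr \<rho> \<le> \<tau>' \<longleftrightarrow> max_modulus F r \<le> exp (\<tau>' * r powr \<rho>)" .
  qed
  then show ?thesis unfolding entire_type_def Limsup_ereal_le_iff by blast
qed

lemma coefficients_le_if_max_modulus_le:
  assumes "F holomorphic_on UNIV" "\<rho> > 0" "\<tau> > 0"
    and "eventually (\<lambda>r. max_modulus F r \<le> exp (\<tau> * r powr \<rho>)) at_top"
  shows "eventually (\<lambda>n. cmod ((deriv ^^ n) F 0 / fact n) \<le> coef_bound \<rho> \<tau> n) sequentially"
proof -
  \<comment> \<open>These radii minimise the bound from Cauchy's estimate. They tend to infinity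
    with \<open>n\<close>, so the growth bound, known only for large radii, applies to almost all of
    them.\<close>
  define R where "R n = (real n / (\<rho> * \<tau>)) powr (1 / \<rho>)" for n
  have "filterlim (\<lambda>n. real n / (\<rho> * \<tau>)) at_top sequentially"
    using assms by real_asymp
  moreover have "filterlim (\<lambda>x. x powr (1 / \<rho>)) at_top at_top"
    using assms by real_asymp
  ultimately have "filterlim R at_top sequentially"
    unfolding R_def by (rule filterlim_compose[rotated])
  from eventually_compose_filterlim[OF assms(4) this] eventually_gt_at_top[of 0]
  show ?thesis
  proof eventually_elim
    case (elim n)
    have "R n > 0" using elim assms by (simp add: R_def)
    have "cmod ((deriv ^^ n) F 0 / fact n) * R n ^ n \<le> exp (\<tau> * R n powr \<rho>)"
      using Cauchy_coefficient_estimate[OF assms(1) \<open>R n > 0\<close>] elim(1) order_trans by blast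
    then show ?case
      using coef_bound_eq_at_optimal_radius[OF assms(2,3) elim(2)] \<open>R n > 0\<close>
      unfolding R_def[symmetric] by (simp add: pos_le_divide_eq)
  qed
qed

text \<open>Comparing with a slightly larger radius \<open>q r\<close> turns the bound on each single term
  into a geometric series.\<close>

lemma max_modulus_le_if_coefficients_le:
  fixes a :: "nat \<Rightarrow> complex"
  assumes F: "\<And>z. (\<lambda>n. a n * z ^ n) sums F z"
    and "\<rho> > 0" "\<tau> > 0" "\<tau> < \<tau>'"
    and ev: "eventually (\<lambda>n. cmod (a n) \<le> coef_bound \<rho> \<tau> n) sequentially"
  shows "eventually (\<lambda>r. max_modulus F r \<le> exp (\<tau>' * r powr \<rho>)) at_top"
proof -
  define \<tau>1 where "\<tau>1 = (\<tau> + \<tau>') / 2"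
  \<comment> \<open>The choice gives \<open>\<tau> * q powr \<rho> = \<tau>1\<close>: the bound at
    radius \<open>q * r\<close> with constant \<open>\<tau>\<close> is the one at radius
    \<open>r\<close> with \<open>\<tau>1\<close>.\<close>
  define q where "q = (\<tau>1 / \<tau>) powr (1 / \<rho>)"
  have \<tau>1: "\<tau> < \<tau>1" "\<tau>1 < \<tau>'" using assms by (auto simp: \<tau>1_def)
  have q: "q > 1" "q powr \<rho> = \<tau>1 / \<tau>"
    using assms \<tau>1 by (auto simp: q_def powr_powr intro!: gr_one_powr)
  from ev obtain K where K: "\<And>n. n \<ge> K \<Longrightarrow> cmod (a n) \<le> coef_bound \<rho> \<tau> n"
    by (auto simp: eventually_sequentially)
  define C where "C = (\<Sum>n\<le>K. cmod (a n))"
  define D where "D = 1 / (1 - 1 / q)"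
  \<comment> \<open>The second summand covers the indices up to \<open>K\<close>. All others exceed
    \<open>K\<close> and are therefore positive, as \<open>coef_bound_mult_power_le\<close>
    requires.\<close>
  define B where "B r = exp (\<tau>1 * r powr \<rho>) + C * (q * r) ^ K" for r
  have "C \<ge> 0" by (simp add: C_def sum_nonneg)
  have le: "max_modulus F r \<le> D * B r" if "r \<ge> 1" for r
  proof (rule max_modulus_le)
    fix z assume z: "cmod z = r"
    have qr: "q * r \<ge> 1" "q * r > 0" using q(1) that by (simp_all add: mult_ge1_I less_imp_le)
    have term_le: "cmod (a n * z ^ n) \<le> B r * (1 / q) ^ n" for n
    proof -
      have "cmod (a n) * (q * r) ^ n \<le> B r"
      proof (cases "n > K")
        case True
        have "cmod (a n) * (q * r) ^ n \<le> coef_bound \<rho> \<tau> n * (q * r) ^ n"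
          using K[of n] True qr by (intro mult_right_mono) auto
        also have "\<dots> \<le> exp (\<tau> * (q * r) powr \<rho>)"
          using assms True qr by (intro coef_bound_mult_power_le) auto
        also have "\<tau> * (q * r) powr \<rho> = \<tau>1 * r powr \<rho>"
          using q assms that by (simp add: powr_mult)
        also have "exp (\<tau>1 * r powr \<rho>) \<le> B r"
          using \<open>C \<ge> 0\<close> qr by (simp add: B_def)
        finally show ?thesis .
      next
        case False
        have "cmod (a n) * (q * r) ^ n \<le> C * (q * r) ^ K"
          using False qr unfolding C_def
          by (intro mult_mono power_increasing member_le_sum sum_nonneg) auto
        also have "\<dots> \<le> B r" by (simp add: B_def)
        finally show ?thesis .
      qed
      then have "cmod (a n) * (q * r) ^ n * (1 / q) ^ n \<le> B r * (1 / q) ^ n"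
        using q by (intro mult_right_mono) auto
      then show ?thesis
        using q z by (simp add: norm_mult norm_power power_mult_distrib power_one_over)
    qed
    have geo: "(\<lambda>n. B r * (1 / q) ^ n) sums (B r * D)"
      unfolding D_def using q by (intro sums_mult geometric_sums) auto
    have "cmod (F z) = cmod (\<Sum>n. a n * z ^ n)"
      using F by (simp add: sums_iff)
    also have "\<dots> \<le> (\<Sum>n. B r * (1 / q) ^ n)"
      using geo term_le by (intro norm_suminf_le) (auto simp: sums_iff)
    finally show "cmod (F z) \<le> D * B r" using geo by (simp add: sums_iff mult.commute)
  qed (use that in simp)
  \<comment> \<open>The gap between \<open>\<tau>1\<close> and \<open>\<tau>'\<close> absorbs the
    constant \<open>D\<close> and the polynomial part of \<open>B\<close>.\<close>
  have "((\<lambda>r. D * B r / exp (\<tau>' * r powr \<rho>)) \<longlongrightarrow> 0) at_top"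
  proof -
    have \<tau>: "\<tau>1 - \<tau>' < 0" "\<tau>' > 0" using \<tau>1 assms by auto
    have "((\<lambda>r::real. exp ((\<tau>1 - \<tau>') * r powr \<rho>)) \<longlongrightarrow> 0) at_top"
      using \<tau> \<open>\<rho> > 0\<close> by real_asymp
    moreover have "((\<lambda>r::real. r ^ K / exp (\<tau>' * r powr \<rho>)) \<longlongrightarrow> 0) at_top"
      using \<tau> \<open>\<rho> > 0\<close> by real_asymp
    ultimately have "((\<lambda>r. D * (exp ((\<tau>1 - \<tau>') * r powr \<rho>)
        + C * q ^ K * (r ^ K / exp (\<tau>' * r powr \<rho>)))) \<longlongrightarrow> D * (0 + C * q ^ K * 0)) at_top"
      by (intro tendsto_intros)
    then show ?thesis
      by (simp add: B_def left_diff_distrib exp_diff add_divide_distrib power_mult_distrib algebra_simps)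
  qed
  then have "eventually (\<lambda>r. D * B r / exp (\<tau>' * r powr \<rho>) < 1) at_top"
    by (rule order_tendstoD) simp
  then show ?thesis
    using eventually_ge_at_top[of 1]
  proof eventually_elim
    case (elim r)
    with le[of r] show ?case by simp
  qed
qed

section \<open>The order as a consequence of the type\<close>

lemma entire_taylor_sums:
  assumes "F holomorphic_on UNIV"
  shows "(\<lambda>n. (deriv ^^ n) F 0 / fact n * z ^ n) sums F z"
  using holomorphic_power_series[of F 0 "cmod z + 1" z] holomorphic_on_subset[OF assms] by simp

text \<open>A positive type excludes constants, and Cauchy's estimate for a nonzero coefficient of
  positive index forces growth. Values above \<open>1\<close> make the inner logarithm in the order
  positive, so that the iterated logarithm is monotone.\<close>

lemma eventually_max_modulus_gt_1:
  assumes "F holomorphic_on UNIV" "\<rho> > 0" "\<sigma> > 0" "entire_type F \<rho> = ereal \<sigma>"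
  shows "eventually (\<lambda>r. max_modulus F r > 1) at_top"
proof -
  define a where "a n = (deriv ^^ n) F 0 / fact n" for n
  have "\<exists>n>0. a n \<noteq> 0"
  proof (rule ccontr)
    assume "\<not> ?thesis"
    then have "eventually (\<lambda>n. cmod (a n) \<le> coef_bound \<rho> (\<sigma> / 2) n) sequentially"
      by (intro eventually_mono[OF eventually_gt_at_top[of 0]])
        (metis coef_bound_def norm_zero powr_ge_zero)
    then have "\<forall>\<tau>>\<sigma> / 2. eventually (\<lambda>r. max_modulus F r \<le> exp (\<tau> * r powr \<rho>)) at_top"
      using entire_taylor_sums[OF assms(1)] assms(2,3)
      by (auto simp: a_def intro!: max_modulus_le_if_coefficients_le[where \<tau> = "\<sigma> / 2"])
    then have "entire_type F \<rho> \<le> ereal (\<sigma> / 2)"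
      using assms by (subst entire_type_le_iff) auto
    with assms show False by simp
  qed
  then obtain n where n: "n > 0" "a n \<noteq> 0" by blast
  have "filterlim (\<lambda>r. cmod (a n) * r ^ n) at_top at_top"
    using n by (intro filterlim_tendsto_pos_mult_at_top[OF tendsto_const] filterlim_pow_at_top filterlim_ident) auto
  then have "eventually (\<lambda>r. cmod (a n) * r ^ n > 1) at_top"
    by (simp add: filterlim_at_top_dense)
  then show ?thesis
    using eventually_gt_at_top[of 0]
    by eventually_elim (use order_less_le_trans Cauchy_coefficient_estimate[OF assms(1)] in \<open>unfold a_def, blast\<close>)
qed

text \<open>A finite type bounds \<open>ln M\<close> by a multiple of \<open>r powr \<rho>\<close>,
  hence by every higher power. An order below \<open>\<rho>\<close> would bound it by a lower power,
  which is eventually less than any positive multiple of \<open>r powr \<rho>\<close>, and the type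
  would be at most \<open>\<sigma> / 2\<close>.\<close>

lemma entire_order_eq_if_entire_type_eq:
  assumes "F holomorphic_on UNIV" "\<rho> > 0" "\<sigma> > 0" "entire_type F \<rho> = ereal \<sigma>"
  shows "entire_order F = ereal \<rho>"
proof (rule antisym)
  note gt_1 = eventually_max_modulus_gt_1[OF assms]
  show "entire_order F \<le> ereal \<rho>"
    unfolding entire_order_def Limsup_ereal_le_iff
  proof (intro allI impI)
    fix \<rho>' assume "\<rho>' > \<rho>"
    have "eventually (\<lambda>r. max_modulus F r \<le> exp (2 * \<sigma> * r powr \<rho>)) at_top"
      using assms entire_type_le_iff[OF assms(1,3), of \<rho>] by simp
    moreover have "eventually (\<lambda>r. 2 * \<sigma> * r powr \<rho> \<le> r powr \<rho>') at_top"
      using assms \<open>\<rho>' > \<rho>\<close> by real_asymp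
    ultimately show "eventually (\<lambda>r. ln (ln (max_modulus F r)) / ln r \<le> \<rho>') at_top"
      using gt_1 eventually_gt_at_top[of 1]
    proof eventually_elim
      case (elim r)
      then have "max_modulus F r \<le> exp (r powr \<rho>')"
        using order_trans exp_le_cancel_iff by blast
      then have "ln (max_modulus F r) \<le> r powr \<rho>'" using elim by (simp add: ln_le_iff_le_exp)
      then have "ln (ln (max_modulus F r)) \<le> ln (r powr \<rho>')"
        using elim by (subst ln_le_cancel_iff) auto
      then show ?case using elim by (simp add: field_simps)
    qed
  qed
  show "ereal \<rho> \<le> entire_order F"
  proof (rule ccontr)
    assume "\<not> ?thesis"
    then obtain t where t: "entire_order F < ereal t" "ereal t < ereal \<rho>"
      using ereal_dense2[of "entire_order F" "ereal \<rho>"] by (auto simp only: not_le)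
    \<comment> \<open>The bound \<open>t\<close> on the limit superior yields eventual bounds by
      larger numbers only, so one more number below \<open>\<rho>\<close> is inserted.\<close>
    define t' where "t' = (t + \<rho>) / 2"
    have t': "t < t'" "t' < \<rho>" using t by (auto simp: t'_def)
    have "entire_order F \<le> ereal t" using t by simp
    then have ev: "eventually (\<lambda>r. ln (ln (max_modulus F r)) / ln r \<le> t') at_top"
      unfolding entire_order_def Limsup_ereal_le_iff using t' by blast
    have "eventually (\<lambda>r. max_modulus F r \<le> exp (\<tau> * r powr \<rho>)) at_top" if "\<tau> > \<sigma> / 2" for \<tau>
    proof -
      have "\<tau> > 0" using that assms by simp
      then have "eventually (\<lambda>r. r powr t' \<le> \<tau> * r powr \<rho>) at_top"
        using t' assms by real_asymp
      with ev gt_1 eventually_gt_at_top[of 1] show ?thesis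
      proof eventually_elim
        case (elim r)
        then have "ln (ln (max_modulus F r)) \<le> ln (r powr t')" by (simp add: field_simps)
        then have "ln (max_modulus F r) \<le> r powr t'" using elim by (subst (asm) ln_le_cancel_iff) auto
        then have "ln (max_modulus F r) \<le> \<tau> * r powr \<rho>" using elim by linarith
        then show ?case using elim by (simp add: ln_le_iff_le_exp)
      qed
    qed
    then have "entire_type F \<rho> \<le> ereal (\<sigma> / 2)"
      using assms by (subst entire_type_le_iff) auto
    with assms show False by simp
  qed
qed

section \<open>Approximation in rotation-invariant spaces\<close>

lemma integral_cis_of_int:
  "(LINT t|lebesgue_on {0..2*pi}. cis (of_int k * t)) = (if k = 0 then complex_of_real (2 * pi) else 0)"
proof -
  have "(LINT t|lebesgue_on {0..2*pi}. cis (of_int k * t)) = integral {0..2*pi} (\<lambda>t. cis (of_int k * t))"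
    by (intro lebesgue_integral_eq_integral continuous_imp_integrable_real continuous_intros) auto
  also have "((\<lambda>t. cis (of_int k * t)) has_integral (if k = 0 then complex_of_real (2 * pi) else 0)) {0..2*pi}"
  proof (cases "k = 0")
    case True
    then show ?thesis using has_integral_const_real[of "1::complex" 0 "2*pi"] by (simp add: scaleR_conv_of_real)
  next
    case False
    define G where "G t = cis (of_int k * t) / (\<i> * of_int k)" for t :: real
    have "(G has_vector_derivative cis (of_int k * t)) (at t within {0..2*pi})" for t
    proof -
      have "((\<lambda>w. exp (\<i> * of_int k * w) / (\<i> * of_int k)) has_field_derivative exp (\<i> * of_int k * of_real t))
          (at (of_real t))"
        using False by (auto intro!: derivative_eq_intros)
      from has_vector_derivative_real_field[OF this] show ?thesis
        by (simp add: G_def[abs_def] cis_conv_exp mult.assoc has_vector_derivative_at_within)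
    qed
    then have "((\<lambda>t. cis (of_int k * t)) has_integral (G (2*pi) - G 0)) {0..2*pi}"
      by (intro fundamental_theorem_of_calculus) auto
    moreover have "cis (of_int k * (2*pi)) = 1"
      using cis_multiple_2pi[of "of_int k"] by (simp add: mult_ac)
    ultimately show ?thesis using False by (simp add: G_def)
  qed
  then have "integral {0..2*pi} (\<lambda>t. cis (of_int k * t)) = (if k = 0 then complex_of_real (2 * pi) else 0)"
    by (rule integral_unique)
  finally show ?thesis .
qed

text \<open>As a relation, it lets coefficient sequences of polynomials, sections and unknown limits
  be combined linearly without recourse to derivatives.\<close>

definition taylor_on_disc :: "(nat \<Rightarrow> complex) \<Rightarrow> (complex \<Rightarrow> complex) \<Rightarrow> bool" where
  "taylor_on_disc a f \<longleftrightarrow> (\<forall>z\<in>ball 0 1. (\<lambda>n. a n * z ^ n) sums f z)"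

lemma taylor_on_disc_diff:
  "taylor_on_disc a f \<Longrightarrow> taylor_on_disc b g \<Longrightarrow> taylor_on_disc (\<lambda>n. a n - b n) (\<lambda>z. f z - g z)"
  by (auto simp: taylor_on_disc_def left_diff_distrib intro!: sums_diff)

lemma taylor_on_disc_restrD:
  "(\<And>z. z \<in> ball 0 1 \<Longrightarrow> (\<lambda>n. a n * z ^ n) sums F z) \<Longrightarrow> taylor_on_disc a (restrD F)"
  by (auto simp: taylor_on_disc_def restrD_def)

lemma taylor_on_disc_poly: "taylor_on_disc (coeff p) (restrD (poly p))"
proof (rule taylor_on_disc_restrD)
  fix z :: complex
  have "(\<lambda>n. coeff p n * z ^ n) sums (\<Sum>n\<le>degree p. coeff p n * z ^ n)"
    by (rule sums_finite) (auto simp: coeff_eq_0)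
  then show "(\<lambda>n. coeff p n * z ^ n) sums poly p z" by (simp add: poly_altdef)
qed

text \<open>Integrating the Taylor series term by term, orthogonality of the characters leaves only
  the term of index \<open>n\<close>.\<close>

lemma integral_rotation_cis:
  assumes "taylor_on_disc a f" "cmod z < 1"
  shows "(LINT t|lebesgue_on {0..2*pi}. f (z * cis t) * cis (- (real n * t))) = 2 * complex_of_real pi * (a n * z ^ n)"
proof -
  define M where "M = lebesgue_on {0..2*pi}"
  define h where "h k t = a k * z ^ k * cis (of_int (int k - int n) * t)" for k t
  have int_h: "integrable M (h k)" for k
    unfolding M_def h_def by (intro continuous_imp_integrable_real continuous_intros)
  \<comment> \<open>Convergence at this larger radius yields absolute convergence at
    \<open>z\<close>. The moduli of \<open>h k t\<close> do not depend on \<open>t\<close>, so this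
    justifies exchanging sum and integral.\<close>
  define r where "r = (cmod z + 1) / 2"
  have r: "cmod z < r" "0 \<le> r" "r < 1" using assms by (auto simp: r_def)
  then have "(\<lambda>k. a k * of_real r ^ k) sums f (of_real r)"
    using assms unfolding taylor_on_disc_def by simp
  then have "summable (\<lambda>k. a k * of_real r ^ k)" by (rule sums_summable)
  then have summ: "summable (\<lambda>k. cmod (a k * z ^ k))"
    by (rule powser_insidea) (use r in simp)
  have norm_h: "cmod (h k t) = cmod (a k * z ^ k)" for k t
    by (simp add: h_def norm_mult)
  have [simp]: "measure M (space M) = 2 * pi" by (simp add: M_def measure_restrict_space)
  have "(LINT t|M. f (z * cis t) * cis (- (real n * t))) = (LINT t|M. (\<Sum>k. h k t))"
  proof (rule Bochner_Integration.integral_cong[OF refl])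
    fix t
    have "(\<lambda>k. a k * (z * cis t) ^ k) sums f (z * cis t)"
      using assms by (auto simp: taylor_on_disc_def norm_mult)
    then have "(\<lambda>k. a k * (z * cis t) ^ k * cis (- (real n * t))) sums (f (z * cis t) * cis (- (real n * t)))"
      by (rule sums_mult2)
    also have "(\<lambda>k. a k * (z * cis t) ^ k * cis (- (real n * t))) = (\<lambda>k. h k t)"
    proof
      fix k
      have "cis t ^ k * cis (- (real n * t)) = cis (of_int (int k - int n) * t)"
        unfolding Complex.DeMoivre cis_mult by (simp add: left_diff_distrib)
      then show "a k * (z * cis t) ^ k * cis (- (real n * t)) = h k t"
        by (simp add: h_def power_mult_distrib mult.assoc)
    qed
    finally show "f (z * cis t) * cis (- (real n * t)) = (\<Sum>k. h k t)" by (simp add: sums_iff)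
  qed
  also have "\<dots> = (\<Sum>k. LINT t|M. h k t)"
    using int_h summ by (intro integral_suminf) (auto simp: norm_h intro!: summable_mult)
  also have "(\<lambda>k. LINT t|M. h k t) = (\<lambda>k. if k = n then 2 * complex_of_real pi * (a n * z ^ n) else 0)"
    unfolding h_def M_def using integral_cis_of_int[of "int k - int n" for k] by (auto simp: fun_eq_iff)
  also have "(\<Sum>k. if k = n then 2 * complex_of_real pi * (a n * z ^ n) else 0) = 2 * complex_of_real pi * (a n * z ^ n)"
    using sums_single[of n "\<lambda>_. 2 * complex_of_real pi * (a n * z ^ n)"] by (simp add: sums_iff)
  finally show ?thesis by (simp add: M_def)
qed

section \<open>The normed space and its Taylor coefficients\<close>

locale analytic_banach =
  fixes X :: "(complex \<Rightarrow> complex) set" and N :: "(complex \<Rightarrow> complex) \<Rightarrow> real"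
  assumes space: "banach_analytic_space X N"
begin

abbreviation "m \<equiv> monomial_norm N"

lemma analytic: "f \<in> X \<Longrightarrow> f analytic_on ball 0 1"
  and outside: "f \<in> X \<Longrightarrow> z \<notin> ball 0 1 \<Longrightarrow> f z = 0"
  and zero_in: "(\<lambda>z. 0) \<in> X"
  and add_in: "f \<in> X \<Longrightarrow> g \<in> X \<Longrightarrow> (\<lambda>z. f z + g z) \<in> X"
  and scale_in: "f \<in> X \<Longrightarrow> (\<lambda>z. c * f z) \<in> X"
  and N_nonneg: "f \<in> X \<Longrightarrow> N f \<ge> 0"
  and N_eq_0_iff: "f \<in> X \<Longrightarrow> N f = 0 \<longleftrightarrow> f = (\<lambda>z. 0)"
  and N_scale: "f \<in> X \<Longrightarrow> N (\<lambda>z. c * f z) = cmod c * N f"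
  and N_triangle: "f \<in> X \<Longrightarrow> g \<in> X \<Longrightarrow> N (\<lambda>z. f z + g z) \<le> N f + N g"
  and entire_in: "F holomorphic_on UNIV \<Longrightarrow> restrD F \<in> X"
  using space unfolding banach_analytic_space_def by simp_all

lemma complete:
  assumes "\<And>n. s n \<in> X" "\<And>e. e > 0 \<Longrightarrow> \<exists>M. \<forall>m\<ge>M. \<forall>n\<ge>M. N (\<lambda>z. s m z - s n z) < e"
  obtains g where "g \<in> X" "(\<lambda>n. N (\<lambda>z. s n z - g z)) \<longlonglongrightarrow> 0"
proof -
  have "\<forall>s. (\<forall>n. s n \<in> X) \<and> (\<forall>e>0. \<exists>M. \<forall>m\<ge>M. \<forall>n\<ge>M. N (\<lambda>z. s m z - s n z) < e)
      \<longrightarrow> (\<exists>g\<in>X. (\<lambda>n. N (\<lambda>z. s n z - g z)) \<longlonglongrightarrow> 0)"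
    using space unfolding banach_analytic_space_def by (elim conjE)
  from this[rule_format, of s] assms that show thesis by auto
qed

lemma convolution:
  fixes g :: "real \<Rightarrow> complex"
  assumes "f \<in> X" "integrable (lebesgue_on {0..2*pi}) g"
  shows "N (restrD (\<lambda>z. (1 / (2*pi)) * (LINT t|lebesgue_on {0..2*pi}. f (z * cis t) * g t)))
    \<le> (1 / (2*pi)) * (LINT t|lebesgue_on {0..2*pi}. cmod (g t)) * N f"
  using space assms unfolding banach_analytic_space_def Let_def by blast

lemma diff_in: "f \<in> X \<Longrightarrow> g \<in> X \<Longrightarrow> (\<lambda>z. f z - g z) \<in> X"
  using add_in[of f "\<lambda>z. -1 * g z"] scale_in[of g "-1"] by simp

lemma N_diff_commute: "f \<in> X \<Longrightarrow> g \<in> X \<Longrightarrow> N (\<lambda>z. f z - g z) = N (\<lambda>z. g z - f z)"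
  using N_scale[of "\<lambda>z. f z - g z" "-1"] diff_in[of f g] by simp

lemma N_diff_triangle:
  "f \<in> X \<Longrightarrow> g \<in> X \<Longrightarrow> h \<in> X \<Longrightarrow> N (\<lambda>z. f z - h z) \<le> N (\<lambda>z. f z - g z) + N (\<lambda>z. g z - h z)"
  using N_triangle[of "\<lambda>z. f z - g z" "\<lambda>z. g z - h z"] diff_in[of f g] diff_in[of g h] by simp

lemma taylor_on_disc_ex:
  assumes "f \<in> X"
  shows "\<exists>a. taylor_on_disc a f"
proof -
  have "f holomorphic_on ball 0 1"
    using analytic[OF assms] by (rule analytic_imp_holomorphic)
  then have "(\<lambda>n. (deriv ^^ n) f 0 / fact n * z ^ n) sums f z" if "z \<in> ball 0 1" for z
    using holomorphic_power_series[of f 0 1 z] that by simp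
  then have "taylor_on_disc (\<lambda>n. (deriv ^^ n) f 0 / fact n) f"
    by (simp add: taylor_on_disc_def)
  then show ?thesis by blast
qed

text \<open>The series decides the values inside the disc and the vanishing convention those
  outside. This identifies a limit supplied by completeness with \<open>f\<close>.\<close>

lemma eq_if_same_taylor:
  assumes "f \<in> X" "g \<in> X" "taylor_on_disc a f" "taylor_on_disc a g"
  shows "f = g"
proof
  fix z
  show "f z = g z"
  proof (cases "z \<in> ball 0 1")
    case True
    then have "(\<lambda>n. a n * z ^ n) sums f z" "(\<lambda>n. a n * z ^ n) sums g z"
      using assms(3,4) unfolding taylor_on_disc_def by blast+
    then show ?thesis by (rule sums_unique2)
  qed (simp add: outside assms(1,2))
qed

lemma monomial_in: "restrD (\<lambda>z. z ^ n) \<in> X"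
  by (intro entire_in holomorphic_intros)

lemma N_scaled_monomial: "N (restrD (\<lambda>z. c * z ^ n)) = cmod c * m n"
proof -
  have "restrD (\<lambda>z. c * z ^ n) = (\<lambda>z. c * restrD (\<lambda>z. z ^ n) z)"
    by (auto simp: restrD_def fun_eq_iff)
  then show ?thesis using N_scale[OF monomial_in, of c n] by (simp add: monomial_norm_def)
qed

lemma monomial_norm_pos: "m n > 0"
proof -
  have "restrD (\<lambda>z. z ^ n) (1 / 2) \<noteq> 0" by (simp add: restrD_def)
  then have "m n \<noteq> 0" using N_eq_0_iff[OF monomial_in] unfolding monomial_norm_def by metis
  then show ?thesis using N_nonneg[OF monomial_in] by (simp add: monomial_norm_def order_less_le)
qed

text \<open>Convolution with \<open>cis (- n t)\<close> extracts the \<open>n\<close>-th Taylor term.\<close>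

lemma coefficient_le_norm:
  assumes "f \<in> X" "taylor_on_disc a f"
  shows "cmod (a n) * m n \<le> N f"
proof -
  define g where "g t = cis (- (real n * t))" for t
  have "integrable (lebesgue_on {0..2*pi}) g"
    unfolding g_def by (intro continuous_imp_integrable_real continuous_intros)
  note conv = convolution[OF assms(1) this]
  have "restrD (\<lambda>z. (1 / (2*pi)) * (LINT t|lebesgue_on {0..2*pi}. f (z * cis t) * g t)) = restrD (\<lambda>z. a n * z ^ n)"
    unfolding restrD_def g_def by (rule ext) (simp add: integral_rotation_cis[OF assms(2)])
  moreover have "(LINT t|lebesgue_on {0..2*pi}. cmod (g t)) = 2 * pi"
    by (simp add: g_def measure_restrict_space)
  ultimately show ?thesis using conv by (simp add: N_scaled_monomial)
qed

section \<open>Norm convergence of Taylor sections\<close>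

text \<open>General index sets are allowed because differences of sections are blocks
  \<open>{i..<j}\<close>.\<close>

definition partial_sum :: "(nat \<Rightarrow> complex) \<Rightarrow> nat set \<Rightarrow> complex \<Rightarrow> complex" where
  "partial_sum a I = restrD (\<lambda>z. \<Sum>k\<in>I. a k * z ^ k)"

lemma partial_sum_in: "partial_sum a I \<in> X"
  unfolding partial_sum_def by (intro entire_in holomorphic_intros)

lemma partial_sum_diff:
  "i \<le> j \<Longrightarrow> (\<lambda>z. partial_sum a {..<j} z - partial_sum a {..<i} z) = partial_sum a {i..<j}"
  by (auto simp: partial_sum_def restrD_def fun_eq_iff sum_diff_nat_ivl simp flip: atLeast0LessThan)

lemma N_partial_sum_le: "finite I \<Longrightarrow> N (partial_sum a I) \<le> (\<Sum>k\<in>I. cmod (a k) * m k)"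
proof (induction I rule: finite_induct)
  case empty
  then show ?case using N_eq_0_iff[OF zero_in] by (simp add: partial_sum_def restrD_def)
next
  case (insert i I)
  have "partial_sum a (insert i I) = (\<lambda>z. restrD (\<lambda>z. a i * z ^ i) z + partial_sum a I z)"
    using insert by (auto simp: partial_sum_def restrD_def fun_eq_iff)
  moreover have "restrD (\<lambda>z. a i * z ^ i) \<in> X" by (intro entire_in holomorphic_intros)
  ultimately have "N (partial_sum a (insert i I)) \<le> cmod (a i) * m i + N (partial_sum a I)"
    using N_triangle[OF _ partial_sum_in, of "restrD (\<lambda>z. a i * z ^ i)" a I] by (simp add: N_scaled_monomial)
  with insert show ?case by simp
qed

lemma taylor_partial_sum: "taylor_on_disc (\<lambda>k. if k < n then a k else 0) (partial_sum a {..<n})"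
  unfolding partial_sum_def
proof (rule taylor_on_disc_restrD)
  fix z :: complex
  have "(\<lambda>k. if k \<in> {..<n} then a k * z ^ k else 0) sums (\<Sum>k<n. a k * z ^ k)"
    by (rule sums_If_finite_set) simp
  also have "(\<lambda>k. if k \<in> {..<n} then a k * z ^ k else 0) = (\<lambda>k. (if k < n then a k else 0) * z ^ k)"
    by auto
  finally show "(\<lambda>k. (if k < n then a k else 0) * z ^ k) sums (\<Sum>k<n. a k * z ^ k)" .
qed

text \<open>Absolute convergence makes the sections Cauchy, and completeness supplies a limit. It is
  recognised by its coefficients, which are continuous in the norm by
  \<open>coefficient_le_norm\<close>.\<close>

lemma series_converges:
  assumes summ: "summable (\<lambda>k. cmod (a k) * m k)"
  obtains g where "g \<in> X" "taylor_on_disc a g"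
    "\<And>n. N (\<lambda>z. g z - partial_sum a {..<n} z) \<le> (\<Sum>k. cmod (a (k + n)) * m (k + n))"
proof -
  let ?S = "\<lambda>n. partial_sum a {..<n}"
  let ?w = "\<lambda>k. cmod (a k) * m k"
  have w: "?w k \<ge> 0" for k using monomial_norm_pos[of k] by simp
  have diff_le: "N (\<lambda>z. ?S j z - ?S i z) \<le> (\<Sum>k\<in>{i..<j}. ?w k)" if "i \<le> j" for i j
    using N_partial_sum_le[of "{i..<j}" a] that by (simp add: partial_sum_diff)
  have "\<exists>M. \<forall>i\<ge>M. \<forall>j\<ge>M. N (\<lambda>z. ?S i z - ?S j z) < e" if "e > 0" for e
  proof -
    obtain M where M: "\<And>i j. i \<ge> M \<Longrightarrow> norm (sum ?w {i..<j}) < e"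
      using summ \<open>e > 0\<close> unfolding summable_Cauchy by blast
    have le: "N (\<lambda>z. ?S j z - ?S i z) < e" if "M \<le> i" "i \<le> j" for i j
      using M[of i j] diff_le[of i j] that by simp
    have "N (\<lambda>z. ?S i z - ?S j z) < e" if "M \<le> i" "M \<le> j" for i j
      using that le[of i j] le[of j i] N_diff_commute[OF partial_sum_in partial_sum_in, of a "{..<i}" a "{..<j}"]
      by (cases "i \<le> j") simp_all
    then show ?thesis by blast
  qed
  then obtain g where g: "g \<in> X" and lim: "(\<lambda>n. N (\<lambda>z. ?S n z - g z)) \<longlonglongrightarrow> 0"
    using complete[of ?S] partial_sum_in by blast
  obtain b where b: "taylor_on_disc b g" using taylor_on_disc_ex[OF g] by blast
  have "a k = b k" for k
  proof -
    \<comment> \<open>For \<open>n > k\<close> the section already has the coefficient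
      \<open>a k\<close>, so its distance to the limit dominates a number independent of
      \<open>n\<close>.\<close>
    have "cmod (a k - b k) * m k \<le> N (\<lambda>z. ?S n z - g z)" if "n > k" for n
      using coefficient_le_norm[OF diff_in[OF partial_sum_in g] taylor_on_disc_diff[OF taylor_partial_sum[of n a] b], of k] that
      by simp
    then have "cmod (a k - b k) * m k \<le> 0"
      using lim by (intro tendsto_lowerbound[OF lim]) (auto simp: eventually_sequentially intro!: exI[of _ "Suc k"])
    then show ?thesis using monomial_norm_pos[of k] by (simp add: mult_le_0_iff)
  qed
  then have "taylor_on_disc a g" using b by (metis ext)
  moreover have "N (\<lambda>z. g z - ?S n z) \<le> (\<Sum>k. ?w (k + n))" for n
  proof -
    \<comment> \<open>The section of length \<open>j\<close> is inserted between the limit and the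
      section of length \<open>n\<close>; then \<open>j\<close> tends to infinity.\<close>
    have "N (\<lambda>z. g z - ?S n z) \<le> N (\<lambda>z. ?S j z - g z) + (\<Sum>k. ?w (k + n))" if "j \<ge> n" for j
    proof -
      have "sum ?w {n..<j} = (\<Sum>k<j - n. ?w (k + n))"
        using that sum.shift_bounds_nat_ivl[of ?w 0 n "j - n"] by (simp add: atLeast0LessThan)
      also have "\<dots> \<le> (\<Sum>k. ?w (k + n))"
        using summ w by (intro sum_le_suminf) (auto simp: summable_iff_shift[of ?w])
      finally show ?thesis
        using N_diff_triangle[where h = "?S n", OF g partial_sum_in[of a "{..<j}"] partial_sum_in] diff_le[OF that]
          N_diff_commute[OF g partial_sum_in, of a "{..<j}"] by simp
    qed
    moreover have "(\<lambda>j. N (\<lambda>z. ?S j z - g z) + (\<Sum>k. ?w (k + n))) \<longlonglongrightarrow> 0 + (\<Sum>k. ?w (k + n))"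
      by (intro tendsto_intros lim)
    ultimately show ?thesis
      by (intro tendsto_lowerbound[where f = "\<lambda>j. N (\<lambda>z. ?S j z - g z) + (\<Sum>k. ?w (k + n))"])
        (auto simp: eventually_sequentially intro!: exI[of _ n])
  qed
  ultimately show thesis using that g by blast
qed

section \<open>Best polynomial approximation\<close>

lemma best_approx_le:
  assumes "f \<in> X" "n > 0"
  shows "best_approx N n f \<le> N (\<lambda>z. f z - partial_sum a {..<n} z)"
  unfolding best_approx_def
proof (rule cInf_lower)
  \<comment> \<open>The section is itself a polynomial of admissible degree and hence competes in
    the infimum.\<close>
  let ?p = "\<Sum>k<n. monom (a k) k"
  have "partial_sum a {..<n} = restrD (poly ?p)"
    by (simp add: partial_sum_def restrD_def fun_eq_iff poly_sum poly_monom)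
  moreover have "degree ?p \<le> n - 1"
    using assms by (intro degree_sum_le) (auto intro: order_trans[OF degree_monom_le])
  ultimately show "N (\<lambda>z. f z - partial_sum a {..<n} z)
      \<in> {N (\<lambda>z. f z - restrD (poly p) z) |p. degree p \<le> n - 1}"
    by (intro CollectI exI[of _ ?p]) simp
  have "restrD (poly p) \<in> X" for p by (intro entire_in holomorphic_intros)
  then show "bdd_below {N (\<lambda>z. f z - restrD (poly p) z) |p. degree p \<le> n - 1}"
    using assms by (intro bdd_belowI[of _ 0]) (auto intro!: N_nonneg diff_in)
qed

text \<open>Subtracting an admissible polynomial leaves the \<open>n\<close>-th coefficient of
  \<open>f\<close> unchanged, so \<open>coefficient_le_norm\<close> bounds every competing norm from
  below.\<close>

lemma coefficient_le_best_approx: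
  assumes "f \<in> X" "taylor_on_disc a f" "n > 0"
  shows "cmod (a n) * m n \<le> best_approx N n f"
  unfolding best_approx_def
proof (rule cInf_greatest)
  show "{N (\<lambda>z. f z - restrD (poly p) z) |p. degree p \<le> n - 1} \<noteq> {}"
    by (auto intro!: exI[of _ 0])
  fix x assume "x \<in> {N (\<lambda>z. f z - restrD (poly p) z) |p. degree p \<le> n - 1}"
  then obtain p where p: "x = N (\<lambda>z. f z - restrD (poly p) z)" "degree p \<le> n - 1" by blast
  \<comment> \<open>Here \<open>n > 0\<close> matters: at \<open>n = 0\<close> truncated subtraction
    admits nonzero constants.\<close>
  then have "coeff p n = 0" using assms by (intro coeff_eq_0) auto
  moreover have "restrD (poly p) \<in> X" by (intro entire_in holomorphic_intros)
  ultimately show "cmod (a n) * m n \<le> x"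
    using coefficient_le_norm[OF diff_in taylor_on_disc_diff[OF assms(2) taylor_on_disc_poly], of p n] assms p by simp
qed

text \<open>If \<open>\<mu>\<close> vanished, completeness would put \<open>\<Sum> 2\<^sup>n z\<^sup>n\<close> into the space, although it has a pole at \<open>1/2\<close>.\<close>

lemma monomial_root_limit_pos:
  assumes "(\<lambda>n. m n powr (1 / real n)) \<longlonglongrightarrow> \<mu>"
  shows "\<mu> > 0"
proof (rule ccontr)
  assume "\<not> \<mu> > 0"
  \<comment> \<open>The constant \<open>1 / 4\<close> makes \<open>2 ^ n * m n\<close> at most
    \<open>(1 / 2) ^ n\<close>, so the series of norms converges.\<close>
  then have "eventually (\<lambda>n. m n powr (1 / real n) < 1 / 4) sequentially"
    using assms by (intro order_tendstoD) auto
  then have "eventually (\<lambda>n. norm (cmod (2 ^ n) * m n) \<le> (1 / 2) ^ n) sequentially"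
    using eventually_gt_at_top[of 0]
  proof eventually_elim
    case (elim n)
    have "m n = (m n powr (1 / real n)) ^ n"
      using monomial_norm_pos[of n] elim by (simp add: powr_realpow[symmetric] powr_powr)
    also have "\<dots> \<le> (1 / 4) ^ n" using elim by (intro power_mono) auto
    finally have "2 ^ n * m n \<le> 2 ^ n * (1 / 4) ^ n" by simp
    then show ?case using monomial_norm_pos[of n] by (simp add: norm_power abs_mult power_mult_distrib[symmetric])
  qed
  then have "summable (\<lambda>n. cmod (2 ^ n) * m n)"
    by (rule summable_comparison_test_ev) simp
  then obtain g where "taylor_on_disc (\<lambda>n. 2 ^ n) g" by (rule series_converges)
  then have "(\<lambda>n. 2 ^ n * (1 / 2) ^ n) sums g (1 / 2)"
    by (auto simp: taylor_on_disc_def)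
  then have "summable (\<lambda>n. 1 :: complex)"
    by (simp add: power_mult_distrib[symmetric] sums_iff)
  then show False using summable_LIMSEQ_zero LIMSEQ_const_iff zero_neq_one by metis
qed

text \<open>Completeness bounds \<open>best_approx\<close> by the tail of
  \<open>cmod (a k) * m k\<close>, which lies below a geometric series. Replacing monomial norms by
  powers of \<open>\<mu>\<close> costs exponential factors as small as desired, absorbed by the step
  from \<open>\<tau>\<close> to \<open>\<tau>'\<close>.\<close>

lemma best_approx_ratio_le:
  assumes "f \<in> X" "taylor_on_disc a f"
    and lim: "(\<lambda>n. m n powr (1 / real n)) \<longlonglongrightarrow> \<mu>"
    and "\<rho> > 0" "\<tau> > 0" "\<tau> < \<tau>'"
    and ev: "eventually (\<lambda>n. cmod (a n) \<le> coef_bound \<rho> \<tau> n) sequentially"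
  shows "eventually (\<lambda>n. best_approx N n f / m n \<le> coef_bound \<rho> \<tau>' n) sequentially"
proof -
  define \<tau>1 where "\<tau>1 = (\<tau> + \<tau>') / 2"
  define q where "q = (\<tau>1 / \<tau>) powr (1 / \<rho>)"
  \<comment> \<open>Bounding \<open>m n\<close> by powers of \<open>\<mu> * s\<close> and of
    \<open>\<mu> / s\<close> costs \<open>s ^ n\<close> each; together this is \<open>q ^ n\<close>,
    exactly what turns \<open>\<tau>\<close> into \<open>\<tau>1\<close>.\<close>
  define s where "s = sqrt q"
  define c where "c n = (exp 1 * \<rho> * \<tau> / real n) powr (1 / \<rho>)" for n
  have \<tau>1: "\<tau> < \<tau>1" "\<tau>1 < \<tau>'" using assms by (auto simp: \<tau>1_def)
  have "q > 1" using assms \<tau>1 by (auto simp: q_def intro!: gr_one_powr)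
  then have s: "s > 1" "s * s = q" by (simp_all add: s_def)
  have "\<mu> > 0" by (rule monomial_root_limit_pos[OF lim])
  have m_eq: "m n = (m n powr (1 / real n)) ^ n" if "n > 0" for n
    using monomial_norm_pos[of n] that by (simp add: powr_realpow[symmetric] powr_powr)
  have "eventually (\<lambda>n. m n powr (1 / real n) < \<mu> * s) sequentially"
    by (rule order_tendstoD(2)[OF lim]) (use s \<open>\<mu> > 0\<close> in simp)
  moreover have "eventually (\<lambda>n. m n powr (1 / real n) > \<mu> / s) sequentially"
    by (rule order_tendstoD(1)[OF lim]) (use s \<open>\<mu> > 0\<close> in \<open>simp add: field_simps\<close>)
  ultimately have m_bounds: "eventually (\<lambda>n. (\<mu> / s) ^ n \<le> m n \<and> m n \<le> (\<mu> * s) ^ n) sequentially"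
    using eventually_gt_at_top[of 0]
  proof eventually_elim
    case (elim n)
    have "(\<mu> / s) ^ n \<le> (m n powr (1 / real n)) ^ n" "(m n powr (1 / real n)) ^ n \<le> (\<mu> * s) ^ n"
      using elim s \<open>\<mu> > 0\<close> by (auto intro!: power_mono)
    then show ?case using m_eq[of n] elim by simp
  qed
  have "summable (\<lambda>k. cmod (a k) * m k)"
  proof (rule summable_comparison_test_ev)
    show "summable (\<lambda>k. cmod (a k) * (\<mu> * s) ^ k)"
      by (rule summable_if_coef_bound[OF assms(4,5) ev])
    show "eventually (\<lambda>k. norm (cmod (a k) * m k) \<le> cmod (a k) * (\<mu> * s) ^ k) sequentially"
      using m_bounds
    proof eventually_elim
      case (elim k)
      then show ?case using monomial_norm_pos[of k] by (simp add: abs_mult mult_left_mono)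
    qed
  qed
  then obtain g where g: "g \<in> X" "taylor_on_disc a g"
    "\<And>n. N (\<lambda>z. g z - partial_sum a {..<n} z) \<le> (\<Sum>k. cmod (a (k + n)) * m (k + n))"
    using series_converges by blast
  have "g = f" using eq_if_same_taylor g assms by blast
  have tail: "best_approx N n f \<le> (\<Sum>k. cmod (a (k + n)) * m (k + n))" if "n > 0" for n
    using best_approx_le[OF assms(1) that, of a] g(3)[of n] \<open>g = f\<close> by simp
  have "(\<lambda>n. c n * (\<mu> * s)) \<longlonglongrightarrow> 0"
    using tendsto_mult_right[OF coef_bound_root_tendsto_0[OF assms(4,5)], of "\<mu> * s"] by (simp add: c_def)
  then have "eventually (\<lambda>n. c n * (\<mu> * s) < 1 / 2) sequentially"
    by (rule order_tendstoD) simp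
  \<comment> \<open>The passage from \<open>\<tau>1\<close> to \<open>\<tau>'\<close> pays for the
    factor \<open>2\<close>, the sum of the geometric series with ratio
    \<open>1 / 2\<close>.\<close>
  moreover have "eventually (\<lambda>n. 2 * coef_bound \<rho> \<tau>1 n \<le> coef_bound \<rho> \<tau>' n) sequentially"
    using \<tau>1 assms by (intro coef_bound_eventually_mult_le) auto
  moreover have "eventually (\<lambda>n. \<forall>k\<ge>n. cmod (a k) \<le> coef_bound \<rho> \<tau> k) sequentially"
    using ev by (simp add: eventually_all_ge_at_top)
  moreover have "eventually (\<lambda>n. \<forall>k\<ge>n. (\<mu> / s) ^ k \<le> m k \<and> m k \<le> (\<mu> * s) ^ k) sequentially"
    using m_bounds by (rule eventually_all_ge_at_top)
  ultimately show ?thesis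
    using eventually_gt_at_top[of 0]
  proof eventually_elim
    case (elim n)
    define x where "x = c n * (\<mu> * s)"
    have x: "0 \<le> x" "x < 1 / 2" using elim s \<open>\<mu> > 0\<close> by (auto simp: x_def c_def)
    have term_le: "norm (cmod (a (k + n)) * m (k + n)) \<le> x ^ n * (1 / 2) ^ k" for k
    proof -
      \<comment> \<open>Monotonicity freezes the root at index \<open>n\<close>: then
        \<open>n\<close> factors \<open>x\<close> are kept and the other \<open>k\<close> are
        replaced by \<open>1 / 2\<close>.\<close>
      have "c (k + n) \<le> c n"
        using assms elim unfolding c_def by (intro powr_mono2 divide_left_mono) auto
      have "norm (cmod (a (k + n)) * m (k + n)) = cmod (a (k + n)) * m (k + n)"
        using monomial_norm_pos[of "k + n"] by (simp add: abs_mult)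
      also have "\<dots> \<le> c (k + n) ^ (k + n) * (\<mu> * s) ^ (k + n)"
      proof (rule mult_mono)
        show "cmod (a (k + n)) \<le> c (k + n) ^ (k + n)"
          unfolding c_def using elim assms by (subst coef_bound_eq_power[symmetric]) auto
      qed (use elim monomial_norm_pos[of "k + n"] in \<open>auto simp: c_def\<close>)
      also have "\<dots> \<le> x ^ (k + n)"
        unfolding x_def power_mult_distrib[symmetric] using \<open>c (k + n) \<le> c n\<close> s \<open>\<mu> > 0\<close>
        by (intro power_mono mult_right_mono) (auto simp: c_def)
      also have "\<dots> = x ^ n * x ^ k" by (simp add: power_add mult.commute)
      also have "\<dots> \<le> x ^ n * (1 / 2) ^ k" using x by (intro mult_left_mono power_mono) auto
      finally show ?thesis .
    qed
    have geo: "(\<lambda>k. x ^ n * (1 / 2) ^ k) sums (x ^ n * 2)"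
      using sums_mult[OF geometric_sums[of "1 / 2 :: real"]] by simp
    have "best_approx N n f \<le> (\<Sum>k. cmod (a (k + n)) * m (k + n))" by (rule tail) (use elim in simp)
    also have "\<dots> \<le> norm (\<Sum>k. cmod (a (k + n)) * m (k + n))" by simp
    also have "\<dots> \<le> (\<Sum>k. x ^ n * (1 / 2) ^ k)"
      by (rule norm_suminf_le) (use term_le geo in \<open>auto simp: sums_iff\<close>)
    also have "\<dots> = 2 * x ^ n" using geo by (simp add: sums_iff)
    finally have "best_approx N n f / m n \<le> 2 * x ^ n / (\<mu> / s) ^ n"
      using elim s \<open>\<mu> > 0\<close> x by (intro frac_le) auto
    also have "\<dots> = 2 * (c n * q) ^ n"
      using s \<open>\<mu> > 0\<close> by (simp add: x_def power_mult_distrib power_divide flip: s(2))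
    also have "c n * q = (exp 1 * \<rho> * \<tau>1 / real n) powr (1 / \<rho>)"
      unfolding c_def q_def using assms \<tau>1 elim by (subst powr_mult[symmetric]) (auto simp: mult.assoc)
    also have "2 * \<dots> ^ n = 2 * coef_bound \<rho> \<tau>1 n"
      using assms \<tau>1 elim by (subst coef_bound_eq_power) auto
    also have "\<dots> \<le> coef_bound \<rho> \<tau>' n" using elim assms \<tau>1 by simp
    finally show ?case .
  qed
qed

section \<open>From approximation rates to growth and back\<close>

lemma best_approx_nonneg:
  assumes "f \<in> X"
  shows "best_approx N n f \<ge> 0"
  unfolding best_approx_def
proof (rule cInf_greatest)
  fix x assume "x \<in> {N (\<lambda>z. f z - restrD (poly p) z) |p. degree p \<le> n - 1}"
  then obtain p where p: "x = N (\<lambda>z. f z - restrD (poly p) z)" by blast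
  have "restrD (poly p) \<in> X" by (intro entire_in holomorphic_intros)
  then show "0 \<le> x" unfolding p by (intro N_nonneg diff_in assms)
qed (auto intro!: exI[of _ 0])

lemma limsup_best_approx_le_iff:
  assumes "f \<in> X" "\<rho> > 0" "\<tau> > 0"
  shows "limsup (\<lambda>n. ereal (real n / (exp 1 * \<rho>) * (best_approx N n f / m n) powr (\<rho> / real n))) \<le> ereal \<tau>
    \<longleftrightarrow> (\<forall>\<tau>'>\<tau>. eventually (\<lambda>n. best_approx N n f / m n \<le> coef_bound \<rho> \<tau>' n) sequentially)"
proof -
  have "eventually (\<lambda>n. real n / (exp 1 * \<rho>) * (best_approx N n f / m n) powr (\<rho> / real n) \<le> \<tau>') sequentially
      \<longleftrightarrow> eventually (\<lambda>n. best_approx N n f / m n \<le> coef_bound \<rho> \<tau>' n) sequentially" if "\<tau>' > \<tau>" for \<tau>'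
  proof (rule eventually_cong[OF eventually_gt_at_top[of 0]])
    fix n :: nat assume "n > 0"
    moreover have "best_approx N n f / m n \<ge> 0"
      using best_approx_nonneg[OF assms(1)] monomial_norm_pos[of n] by simp
    ultimately show "real n / (exp 1 * \<rho>) * (best_approx N n f / m n) powr (\<rho> / real n) \<le> \<tau>'
        \<longleftrightarrow> best_approx N n f / m n \<le> coef_bound \<rho> \<tau>' n"
      using assms that by (intro scaled_root_le_iff) auto
  qed
  then show ?thesis unfolding Limsup_ereal_le_iff by blast
qed

lemma coefficients_le_if_best_approx_le:
  assumes "f \<in> X" "taylor_on_disc a f"
    and "eventually (\<lambda>n. best_approx N n f / m n \<le> coef_bound \<rho> \<tau> n) sequentially"
  shows "eventually (\<lambda>n. cmod (a n) \<le> coef_bound \<rho> \<tau> n) sequentially"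
  using assms(3) eventually_gt_at_top[of 0]
proof eventually_elim
  case (elim n)
  then have "cmod (a n) \<le> best_approx N n f / m n"
    using coefficient_le_best_approx[OF assms(1,2)] monomial_norm_pos[of n] by (simp add: pos_le_divide_eq)
  with elim show ?case by simp
qed

text \<open>Both sides concern all constants above \<open>\<tau>\<close> and are linked through the
  Taylor coefficients. Each direction has one lossless passage and one that enlarges the constant,
  so it starts from the midpoint of \<open>\<tau>\<close> and \<open>t\<close>.\<close>

lemma limsup_best_approx_le_iff_entire_type_le:
  assumes "f \<in> X" "F holomorphic_on UNIV" "\<And>z. z \<in> ball 0 1 \<Longrightarrow> F z = f z"
    and lim: "(\<lambda>n. m n powr (1 / real n)) \<longlonglongrightarrow> \<mu>"
    and "\<rho> > 0" "\<tau> > 0"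
  shows "limsup (\<lambda>n. ereal (real n / (exp 1 * \<rho>) * (best_approx N n f / m n) powr (\<rho> / real n))) \<le> ereal \<tau>
    \<longleftrightarrow> entire_type F \<rho> \<le> ereal \<tau>"
proof -
  define a where "a n = (deriv ^^ n) F 0 / fact n" for n
  have F: "(\<lambda>n. a n * z ^ n) sums F z" for z
    unfolding a_def by (rule entire_taylor_sums) (rule assms)
  have a: "taylor_on_disc a f"
    unfolding taylor_on_disc_def using F assms(3) by metis
  have mid: "\<tau> < (\<tau> + t) / 2" "(\<tau> + t) / 2 < t" "0 < (\<tau> + t) / 2" if "t > \<tau>" for t
    using that assms by auto
  show ?thesis
    unfolding limsup_best_approx_le_iff[OF assms(1,5,6)] entire_type_le_iff[OF assms(2,6)]
  proof safe
    fix t assume "t > \<tau>" and "\<forall>t>\<tau>. eventually (\<lambda>n. best_approx N n f / m n \<le> coef_bound \<rho> t n) sequentially"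
    then have "eventually (\<lambda>n. best_approx N n f / m n \<le> coef_bound \<rho> ((\<tau> + t) / 2) n) sequentially"
      using mid[OF \<open>t > \<tau>\<close>] by blast
    then have "eventually (\<lambda>n. cmod (a n) \<le> coef_bound \<rho> ((\<tau> + t) / 2) n) sequentially"
      by (rule coefficients_le_if_best_approx_le[OF assms(1) a])
    then show "eventually (\<lambda>r. max_modulus F r \<le> exp (t * r powr \<rho>)) at_top"
      by (rule max_modulus_le_if_coefficients_le[OF F assms(5) mid(3,2)[OF \<open>t > \<tau>\<close>]])
  next
    fix t assume "t > \<tau>" and "\<forall>t>\<tau>. eventually (\<lambda>r. max_modulus F r \<le> exp (t * r powr \<rho>)) at_top"
    then have "eventually (\<lambda>r. max_modulus F r \<le> exp ((\<tau> + t) / 2 * r powr \<rho>)) at_top"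
      using mid[OF \<open>t > \<tau>\<close>] by blast
    then have "eventually (\<lambda>n. cmod (a n) \<le> coef_bound \<rho> ((\<tau> + t) / 2) n) sequentially"
      unfolding a_def by (rule coefficients_le_if_max_modulus_le[OF assms(2,5) mid(3)[OF \<open>t > \<tau>\<close>]])
    then show "eventually (\<lambda>n. best_approx N n f / m n \<le> coef_bound \<rho> t n) sequentially"
      by (rule best_approx_ratio_le[OF assms(1) a lim assms(5) mid(3,2)[OF \<open>t > \<tau>\<close>]])
  qed
qed

text \<open>The coefficients inherit the bound, with \<open>\<tau> + 1\<close> as some constant
  above \<open>\<tau>\<close>, and the Taylor series then converges in the whole plane.\<close>

lemma entire_extension_if_limsup_best_approx_le:
  assumes "f \<in> X" "\<rho> > 0" "\<tau> > 0"
    and "limsup (\<lambda>n. ereal (real n / (exp 1 * \<rho>) * (best_approx N n f / m n) powr (\<rho> / real n))) \<le> ereal \<tau>"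
  obtains F where "F holomorphic_on UNIV" "\<And>z. z \<in> ball 0 1 \<Longrightarrow> F z = f z"
proof -
  obtain a where a: "taylor_on_disc a f" using taylor_on_disc_ex[OF assms(1)] by blast
  have "eventually (\<lambda>n. best_approx N n f / m n \<le> coef_bound \<rho> (\<tau> + 1) n) sequentially"
    using assms limsup_best_approx_le_iff[OF assms(1-3)] by simp
  then have ev: "eventually (\<lambda>n. cmod (a n) \<le> coef_bound \<rho> (\<tau> + 1) n) sequentially"
    by (rule coefficients_le_if_best_approx_le[OF assms(1) a])
  define F where "F z = (\<Sum>n. a n * z ^ n)" for z
  have F: "(\<lambda>n. a n * z ^ n) sums F z" for z
  proof -
    have "summable (\<lambda>n. norm (a n * z ^ n))"
      unfolding norm_mult norm_power
      by (rule summable_if_coef_bound[OF assms(2) _ ev]) (use assms(3) in simp)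
    then have "summable (\<lambda>n. a n * z ^ n)"
      by (rule summable_norm_cancel)
    then show ?thesis unfolding F_def by (rule summable_sums)
  qed
  moreover have "F z = f z" if "z \<in> ball 0 1" for z
    using F a that sums_unique2 unfolding taylor_on_disc_def by blast
  ultimately show thesis using that sums_holomorphic_UNIV by blast
qed

end

theorem theorem2p3:
  fixes X :: "(complex \<Rightarrow> complex) set" and N :: "(complex \<Rightarrow> complex) \<Rightarrow> real"
    and \<mu> \<rho> \<sigma> :: real and f :: "complex \<Rightarrow> complex"
  assumes "banach_analytic_space X N"
    and "(\<lambda>n. monomial_norm N n powr (1 / real n)) \<longlonglongrightarrow> \<mu>"
    and "f \<in> X"
    and "\<rho> > 0" and "\<sigma> > 0"
  shows "(\<exists>F. F holomorphic_on UNIV \<and> (\<forall>z\<in>ball 0 1. F z = f z) \<and>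
              entire_order F = ereal \<rho> \<and> entire_type F \<rho> = ereal \<sigma>)
         \<longleftrightarrow>
         limsup (\<lambda>n. ereal (real n / (exp 1 * \<rho>) *
                   (best_approx N n f / monomial_norm N n) powr (\<rho> / real n))) = ereal \<sigma>"
    (is "?lhs \<longleftrightarrow> ?L = _")
proof -
  interpret analytic_banach X N by standard (rule assms)
  \<comment> \<open>Valid for any entire extension, this serves both directions: \<open>F\<close> is
    given in one and constructed from the finite limit superior in the other, where the order then
    follows from the type.\<close>
  have iff: "?L = ereal \<sigma> \<longleftrightarrow> entire_type F \<rho> = ereal \<sigma>"
    if "F holomorphic_on UNIV" "\<forall>z\<in>ball 0 1. F z = f z" for F
    using that assms(2-5) by (intro ereal_eq_if_le_iff limsup_best_approx_le_iff_entire_type_le) auto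
  show ?thesis
  proof
    assume ?lhs
    then show "?L = ereal \<sigma>" using iff by blast
  next
    assume L: "?L = ereal \<sigma>"
    then obtain F where F: "F holomorphic_on UNIV" "\<And>z. z \<in> ball 0 1 \<Longrightarrow> F z = f z"
      using entire_extension_if_limsup_best_approx_le[OF assms(3-5)] by auto
    with iff L have "entire_type F \<rho> = ereal \<sigma>" by blast
    with F show ?lhs using entire_order_eq_if_entire_type_eq[OF F(1) assms(4,5)] by blast
  qed
qed

end
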